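(* There exists a non-zero analytic function $g^{*}:S^1\to\mathbb{R}$ with $\int_{S^1} g^{*}(x)\,dx=0$ such that, for the one-parameter family of maps $S_\lambda:S^1\times\mathbb{R}\to S^1\times\mathbb{R}$, $S_\lambda(x,y)=(x',y')$, where $$y'=\lambda g^{*}(x)+y,\qquad x'=x+y' \bmod 1,$$ the function $\lambda\mapsto \rho_V^{\max}(S_\lambda)$, $\lambda\in[0,\infty)$, is not a non-decreasing function of $\lambda$.
   Context: $S^1=\mathbb{R}/\mathbb{Z}$. A function $g:S^1\to\mathbb{R}$ is called analytic if it is induced by a (real-)analytic function $\widetilde g:\mathbb{R}\to\mathbb{R}$ with $\widetilde g(x+1)=\widetilde g(x)$; $\int_{S^1} g(x)\,dx$ means $\int_0^1\widetilde g(x)\,dx$. Let $p_2(x,y)=y$ on $S^1\times\mathbb{R}$. For each $\lambda$, the vertical rotation set $\rho_V(S_\lambda)\subset\mathbb{R}$ is the set of all $\omega\in\mathbb{R}$ for which there is a point $X\in S^1\times\mathbb{R}$ with $$\lim_{n\to\infty}\frac{p_2\circ S_\lambda^n(X)-p_2(X)}{n}=\omega .$$ It is a closed bounded interval $[\rho_V^{\min}(S_\lambda),\rho_V^{\max}(S_\lambda)]$, and $\rho_V^{\max}(S_\lambda)$ denotes its maximum. *)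

theory Defs
  imports "HOL-Analysis.Analysis"
begin

quotient_type circle = real / "\<lambda>x y :: real. x - y \<in> \<int>"
  morphisms rep_circle to_circle
proof (rule equivpI)
  show "reflp (\<lambda>x y :: real. x - y \<in> \<int>)"
    by (simp add: reflp_def)
  show "symp (\<lambda>x y :: real. x - y \<in> \<int>)"
    unfolding symp_def by (metis Ints_minus minus_diff_eq)
  show "transp (\<lambda>x y :: real. x - y \<in> \<int>)"
    unfolding transp_def by (metis Ints_add diff_add_cancel add_diff_eq)
qed

instantiation circle :: ab_group_add
begin

lift_definition zero_circle :: circle is "0 :: real" .

lift_definition plus_circle :: "circle \<Rightarrow> circle \<Rightarrow> circle" is "(+) :: real \<Rightarrow> real \<Rightarrow> real"
  by (metis Ints_add add_diff_add)

lift_definition uminus_circle :: "circle \<Rightarrow> circle" is "uminus :: real \<Rightarrow> real"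
  by (metis Ints_minus minus_diff_minus)

lift_definition minus_circle :: "circle \<Rightarrow> circle \<Rightarrow> circle" is "(-) :: real \<Rightarrow> real \<Rightarrow> real"
  by (metis Ints_diff diff_diff_eq2 diff_diff_eq add_diff_eq diff_add_eq add.commute)

instance
  by standard (transfer; simp)+

end

definition real_analytic :: "(real \<Rightarrow> real) \<Rightarrow> bool" where
  "real_analytic f \<longleftrightarrow>
     (\<forall>x. \<exists>r>0. \<exists>a. \<forall>y. \<bar>y - x\<bar> < r \<longrightarrow> (\<lambda>n. a n * (y - x) ^ n) sums f y)"

definition circle_analytic :: "(circle \<Rightarrow> real) \<Rightarrow> bool" where
  "circle_analytic g \<longleftrightarrow>
     (\<exists>g'. real_analytic g' \<and> (\<forall>x. g' (x + 1) = g' x) \<and> (\<forall>x. g (to_circle x) = g' x))"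

definition circle_integral :: "(circle \<Rightarrow> real) \<Rightarrow> real" where
  "circle_integral g = integral {0..1} (\<lambda>x. g (to_circle x))"

definition std_map :: "(circle \<Rightarrow> real) \<Rightarrow> real \<Rightarrow> circle \<times> real \<Rightarrow> circle \<times> real" where
  "std_map g t = (\<lambda>(x, y). let y' = t * g x + y in (x + to_circle y', y'))"

definition vertical_rotation_set :: "(circle \<times> real \<Rightarrow> circle \<times> real) \<Rightarrow> real set" where
  "vertical_rotation_set S =
     {w. \<exists>X. (\<lambda>n. (snd ((S ^^ n) X) - snd X) / real n) \<longlonglongrightarrow> w}"

(* For every map std_map g t with g analytic of zero mean, the vertical rotation set is a
   nonempty compact interval, so its supremum is its maximum.  Max would be
   unsuitable here, since it is only specified on finite sets. *)
definition rho_V_max :: "(circle \<times> real \<Rightarrow> circle \<times> real) \<Rightarrow> real" where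
  "rho_V_max S = Sup (vertical_rotation_set S)"

end

theory Submission
  imports Defs "HOL-Complex_Analysis.Complex_Analysis"
begin

text \<open>
  The witness is (a conjugate of) Suris' integrable map. For a circle diffeomorphism with lift
  \<open>F\<close>, the map with \<open>g = F + F\<inverse> - 2 id\<close> and parameter 1 leaves the graph \<open>y = x - F\<inverse> x\<close> invariant, so
  all vertical speeds vanish there. Taking for \<open>F\<close> a hyperbolic Moebius transformation (acting on
  \<open>\<real>/2\<int>\<close>) of multiplier close to 0, \<open>g\<close> becomes close to the sawtooth \<open>1 - 2x\<close> on \<open>(0,1)\<close>. For the
  sawtooth and the smaller parameter 3/4, starting near the discontinuity at 0 with a suitable kick
  yields an orbit of period 4 (modulo the reversing symmetry it is determined by a single scalar
  equation) along which \<open>y\<close> increases by 1. The intermediate value theorem produces such an orbit for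
  the smooth \<open>g\<close> too, so the maximal vertical speed at 3/4 is at least 1/4.
\<close>

section \<open>The argument of \<open>1 - c z\<close> on the unit circle, and lifts of Moebius
  maps\<close>

definition phase :: "real \<Rightarrow> real \<Rightarrow> real" where
  "phase c \<theta> = Arg (1 - of_real c * cis \<theta>)"

text \<open>Positivity keeps the number in the right half-plane, where \<open>Arg\<close> has no
  jump and equals an arctangent.\<close>

lemma Re_phase_pos:
  assumes "\<bar>c\<bar> < 1"
  shows "0 < Re (1 - of_real c * cis \<theta>)"
proof -
  have "\<bar>c * cos \<theta>\<bar> \<le> \<bar>c\<bar> * 1"
    unfolding abs_mult by (intro mult_left_mono) auto
  with assms show ?thesis
    by auto
qed

lemma phase_nonzero:
  assumes "\<bar>c\<bar> < 1"
  shows "1 - of_real c * cis \<theta> \<noteq> 0"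
proof
  assume "1 - of_real c * cis \<theta> = 0"
  with Re_phase_pos[OF assms, of \<theta>] show False
    by (simp only: zero_complex.sel less_irrefl)
qed

lemma phase_bound: "\<bar>c\<bar> < 1 \<Longrightarrow> \<bar>phase c \<theta>\<bar> < pi / 2"
  unfolding phase_def
  by (metis Re_phase_pos phase_nonzero Arg_eq_Im_Ln Re_Ln_pos_lt)

lemma phase_arctan:
  assumes "\<bar>c\<bar> < 1"
  shows "phase c \<theta> = arctan (- (c * sin \<theta>) / (1 - c * cos \<theta>))"
  using arg_conv_arctan[OF Re_phase_pos[OF assms, of \<theta>]] by (simp add: phase_def)

lemma phase_minus: "\<bar>c\<bar> < 1 \<Longrightarrow> phase c (- \<theta>) = - phase c \<theta>"
  by (simp add: phase_arctan arctan_minus)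

lemma phase_add_2pi_int: "k \<in> \<int> \<Longrightarrow> phase c (\<theta> + 2 * pi * k) = phase c \<theta>"
  by (simp add: phase_def cis_mult[symmetric] cis_multiple_2pi)

text \<open>Since 1 - c^2 z^2 = (1 - c z)(1 + c z), the arguments add; no wrapping occurs because
  each lies strictly within pi/2 of 0.\<close>

lemma phase_double:
  assumes "\<bar>c\<bar> < 1"
  shows "phase (c\<^sup>2) (2 * \<theta>) = phase c \<theta> + phase (- c) \<theta>"
proof -
  have c': "\<bar>- c\<bar> < 1"
    using assms by simp
  have "1 - of_real (c\<^sup>2) * cis (2 * \<theta>)
      = (1 - of_real c * cis \<theta>) * (1 - of_real (- c) * cis \<theta>)"
    by (simp add: algebra_simps power2_eq_square cis_mult)
  moreover have "Arg ((1 - of_real c * cis \<theta>) * (1 - of_real (- c) * cis \<theta>))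
      = phase c \<theta> + phase (- c) \<theta>"
    using phase_bound[OF assms, of \<theta>] phase_bound[OF c', of \<theta>]
    unfolding phase_def by (intro Arg_times phase_nonzero assms c') auto
  ultimately show ?thesis
    by (simp only: phase_def)
qed

lemma continuous_on_phase:
  fixes f :: "'a::t2_space \<Rightarrow> real"
  assumes "\<bar>c\<bar> < 1" "continuous_on A f"
  shows "continuous_on A (\<lambda>x. phase c (f x))"
proof -
  have "1 - c * cos (f x) \<noteq> 0" for x
    using Re_phase_pos[OF assms(1), of "f x"] by simp
  then show ?thesis
    unfolding phase_arctan[OF assms(1)] by (intro continuous_intros assms(2)) blast
qed

text \<open>A lift of the Moebius transformation \<open>z \<mapsto> (z - c) / (1 - c z)\<close> of the unit circle, in the angle
  coordinate; see \<open>cis_boost\<close>.\<close>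

definition boost :: "real \<Rightarrow> real \<Rightarrow> real" where
  "boost c \<theta> = \<theta> - 2 * phase c \<theta>"

lemma boost_add_2pi_int: "k \<in> \<int> \<Longrightarrow> boost c (\<theta> + 2 * pi * k) = boost c \<theta> + 2 * pi * k"
  by (simp add: boost_def phase_add_2pi_int)

text \<open>With z = \<open>cis \<theta>\<close> and w = 1 - c z, doubling the argument of w gives w
  / \<open>cnj w\<close>, and |z| = 1 turns z * \<open>cnj w\<close> into z - c.\<close>

lemma cis_boost:
  assumes "\<bar>c\<bar> < 1"
  shows "cis (boost c \<theta>) = (cis \<theta> - of_real c) / (1 - of_real c * cis \<theta>)"
proof -
  let ?w = "1 - of_real c * cis \<theta>"
  have w: "?w \<noteq> 0"
    by (rule phase_nonzero[OF assms])
  have "cis (phase c \<theta>) = ?w / of_real (cmod ?w)"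
    using cis_Arg[OF w] by (simp add: phase_def sgn_eq)
  then have "cis (2 * phase c \<theta>) = ?w\<^sup>2 / of_real ((cmod ?w)\<^sup>2)"
    using Complex.DeMoivre[of "phase c \<theta>" 2] by (simp only: power_divide of_real_power of_nat_numeral)
  also have "of_real ((cmod ?w)\<^sup>2) = ?w * cnj ?w"
    by (rule complex_norm_square)
  also have "?w\<^sup>2 / (?w * cnj ?w) = ?w / cnj ?w"
    unfolding power2_eq_square using w by (rule nonzero_mult_divide_mult_cancel_left)
  finally have "cis (boost c \<theta>) = cis \<theta> * cnj ?w / ?w"
    unfolding boost_def cis_divide[symmetric] by (simp only: divide_divide_eq_right)
  also have "cis \<theta> * cnj ?w = cis \<theta> - of_real c"
    by (simp add: algebra_simps cis_cnj cis_mult)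
  finally show ?thesis .
qed

text \<open>The two Moebius maps are mutually inverse, so their lifts compose to the identity up to
  a multiple of 2 pi. By \<open>phase_bound\<close> the total displacement is less than 2 pi, so
  that multiple is 0.\<close>

lemma boost_inverse:
  assumes c: "\<bar>c\<bar> < 1"
  shows "boost c (boost (- c) \<theta>) = \<theta>"
proof -
  let ?z = "cis \<theta>" and ?\<eta> = "boost (- c) \<theta>"
  have c': "\<bar>- c\<bar> < 1"
    using c by simp
  have nz: "1 + of_real c * ?z \<noteq> 0"
    using phase_nonzero[OF c', of \<theta>] by simp
  have "c\<^sup>2 < 1"
    using c by (simp add: abs_square_less_1)
  then have q: "1 - (of_real c)\<^sup>2 \<noteq> (0 :: complex)"
    by (metis less_irrefl of_real_1 of_real_eq_iff of_real_power right_minus_eq)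
  have \<eta>: "cis ?\<eta> = (?z + of_real c) / (1 + of_real c * ?z)"
    using cis_boost[OF c', of \<theta>] by simp
  have "cis ?\<eta> - of_real c = (1 - (of_real c)\<^sup>2) * ?z / (1 + of_real c * ?z)"
    "1 - of_real c * cis ?\<eta> = (1 - (of_real c)\<^sup>2) / (1 + of_real c * ?z)"
    unfolding \<eta> using nz by (simp_all add: field_simps power2_eq_square)
  then have "cis (boost c ?\<eta>) = ?z"
    unfolding cis_boost[OF c] using nz q by simp
  then have "cis (boost c ?\<eta> - \<theta>) = 1"
    by (simp add: cis_divide[symmetric])
  then have "cos (boost c ?\<eta> - \<theta>) = 1"
    by (metis cis.sel(1) one_complex.sel(1))
  then obtain k :: int where k: "boost c ?\<eta> - \<theta> = of_int k * 2 * pi"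
    by (auto simp: cos_one_2pi_int)
  have "\<bar>boost c ?\<eta> - \<theta>\<bar> < 2 * pi"
    using phase_bound[OF c, of ?\<eta>] phase_bound[OF c', of \<theta>] unfolding boost_def by linarith
  then have "\<bar>of_int k\<bar> * (2 * pi) < 1 * (2 * pi)"
    unfolding k by (simp add: abs_mult)
  then have "k = 0"
    by (subst (asm) mult_less_cancel_right_pos) auto
  with k show ?thesis
    by simp
qed

text \<open>The derivative is the Poisson kernel (1 - c^2) / (1 - 2 c cos \<theta> + c^2), which is
  positive.\<close>

lemma boost_strict_mono:
  assumes c: "\<bar>c\<bar> < 1"
  shows "strict_mono (boost c)"
proof (rule strict_monoI)
  fix u v :: real
  assume "u < v"
  then show "boost c u < boost c v"
  proof (rule DERIV_pos_imp_increasing[where f = "boost c"])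
    fix \<theta> :: real
    let ?D = "(1 - c * cos \<theta>)\<^sup>2 + (c * sin \<theta>)\<^sup>2"
    have pos: "1 - c * cos \<theta> > 0"
      using Re_phase_pos[OF c, of \<theta>] by simp
    have D: "?D = 1 - 2 * c * cos \<theta> + c\<^sup>2"
      by (simp add: sin_squared_eq power2_diff power_mult_distrib right_diff_distrib)
    have D0: "?D > 0"
      using pos by (simp add: add_pos_nonneg)
    let ?u = "1 - c * cos \<theta>" and ?s = "c * sin \<theta>"
    have num: "c * x * (1 - c * x) - c * y * (c * y) = c * x - c\<^sup>2 * (y\<^sup>2 + x\<^sup>2)" for x y
      by (simp add: algebra_simps power2_eq_square)
    have "((\<lambda>x. - (c * sin x) / (1 - c * cos x)) has_real_derivative
        - ((c * cos \<theta> * ?u - ?s * ?s) / (?u * ?u))) (at \<theta>)"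
      using pos by (auto intro!: derivative_eq_intros simp: mult.commute)
    from DERIV_chain2[OF DERIV_arctan this[unfolded minus_divide_left]]
    have "((\<lambda>x. arctan (- (c * sin x) / (1 - c * cos x))) has_real_derivative
        inverse (1 + (- ?s / ?u)\<^sup>2) * (- (c * cos \<theta> * ?u - ?s * ?s) / (?u * ?u))) (at \<theta>)" .
    moreover have "inverse (1 + (- ?s / ?u)\<^sup>2) * (N / (?u * ?u)) = N / ?D" for N
    proof -
      have "1 + (- ?s / ?u)\<^sup>2 = ?D / ?u\<^sup>2"
        using pos by (simp add: field_simps)
      then show ?thesis
        using pos by (simp add: power2_eq_square)
    qed
    moreover have "- (c * cos \<theta> * ?u - ?s * ?s) = c\<^sup>2 - c * cos \<theta>"
      unfolding num by simp
    ultimately have d: "((\<lambda>x. arctan (- (c * sin x) / (1 - c * cos x))) has_real_derivative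
        (c\<^sup>2 - c * cos \<theta>) / ?D) (at \<theta>)"
      by (simp only:)
    have "(boost c has_real_derivative 1 - 2 * ((c\<^sup>2 - c * cos \<theta>) / ?D)) (at \<theta>)"
      unfolding boost_def phase_arctan[OF c]
      by (rule derivative_eq_intros d refl)+ simp
    moreover have "1 - 2 * ((c\<^sup>2 - c * cos \<theta>) / ?D) = (1 - c\<^sup>2) / ?D"
    proof -
      have "1 - 2 * (x / y) = (y - 2 * x) / y" if "y \<noteq> 0" for x y :: real
        using that by (simp add: diff_divide_distrib)
      moreover have "?D - 2 * (c\<^sup>2 - c * cos \<theta>) = 1 - c\<^sup>2"
        unfolding D by simp
      ultimately show ?thesis
        using less_imp_neq[OF D0] by metis
    qed
    moreover have "(1 - c\<^sup>2) / ?D > 0"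
      using D0 c by (simp add: abs_square_less_1)
    ultimately show "\<exists>y. (boost c has_real_derivative y) (at \<theta>) \<and> 0 < y"
      by metis
  qed
qed

text \<open>Taking the factor exp(i (\<theta> - pi/2)) out of 1 - q exp(2 i \<theta>) leaves (1 + q)
  sin \<theta> + i (1 - q) cos \<theta>. For q near 1 the result is a linear sawtooth plus a
  correction that is small away from the jump.\<close>

lemma phase_closed_form:
  assumes q: "0 < q" "q < 1" and \<theta>: "0 < \<theta>" "\<theta> < pi"
  shows "phase q (2 * \<theta>) = \<theta> - pi / 2 + arctan ((1 - q) / (1 + q) * cot \<theta>)"
proof -
  let ?\<epsilon> = "(1 - q) / (1 + q)"
  define \<psi> where "\<psi> = arctan (?\<epsilon> * cot \<theta>)"
  have s: "sin \<theta> > 0"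
    using \<theta> by (simp add: sin_gt_zero)
  have cp: "cos \<psi> > 0"
    unfolding \<psi>_def using arctan_bounded[of "?\<epsilon> * cot \<theta>"] by (intro cos_gt_zero_pi) auto
  have "tan \<psi> = ?\<epsilon> * cot \<theta>"
    by (simp only: \<psi>_def tan_arctan)
  moreover have "sin \<psi> = cos \<psi> * tan \<psi>"
    using cp by (simp add: tan_def)
  ultimately have sin_psi: "sin \<psi> = cos \<psi> * (?\<epsilon> * cot \<theta>)"
    by (simp only:)
  define r where "r = (1 + q) * sin \<theta> / cos \<psi>"
  have rp: "r > 0"
    unfolding r_def using s cp q by simp
  have rc: "r * cos \<psi> = (1 + q) * sin \<theta>"
    unfolding r_def using cp by simp
  have rs: "r * sin \<psi> = (1 - q) * cos \<theta>"
    unfolding sin_psi r_def using cp s q by (simp add: cot_def)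
  have "1 - of_real q * cis (2 * \<theta>) = rcis r (\<theta> - pi / 2 + \<psi>)"
  proof -
    have "r * cos (\<theta> - pi / 2 + \<psi>) = sin \<theta> * (r * cos \<psi>) + cos \<theta> * (r * sin \<psi>)"
      "r * sin (\<theta> - pi / 2 + \<psi>) = sin \<theta> * (r * sin \<psi>) - cos \<theta> * (r * cos \<psi>)"
      by (simp_all add: cos_add sin_add cos_diff sin_diff algebra_simps)
    moreover have "sin \<theta> * ((1 + q) * sin \<theta>) + cos \<theta> * ((1 - q) * cos \<theta>) = 1 - q * cos (2 * \<theta>)"
    proof -
      have "sin \<theta> * ((1 + q) * sin \<theta>) + cos \<theta> * ((1 - q) * cos \<theta>)
        = ((sin \<theta>)\<^sup>2 + (cos \<theta>)\<^sup>2) - q * ((cos \<theta>)\<^sup>2 - (sin \<theta>)\<^sup>2)"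
        by (simp add: algebra_simps power2_eq_square)
      then show ?thesis by (simp add: cos_double)
    qed
    moreover have "sin \<theta> * ((1 - q) * cos \<theta>) - cos \<theta> * ((1 + q) * sin \<theta>) = - q * sin (2 * \<theta>)"
      unfolding sin_double by (simp add: algebra_simps)
    ultimately show ?thesis
      by (simp add: complex_eq_iff rc rs)
  qed
  moreover have "- pi < \<theta> - pi / 2 + \<psi>" "\<theta> - pi / 2 + \<psi> \<le> pi"
    using arctan_bounded[of "?\<epsilon> * cot \<theta>"] \<theta> by (auto simp: \<psi>_def)
  ultimately show ?thesis
    unfolding phase_def \<psi>_def[symmetric] using rp by (intro Arg_unique[of r]) (auto simp: rcis_def cis_conv_exp)
qed

text \<open>At a real centre the powers (y - x)^n are real, so taking real parts of the complex
  Taylor coefficients gives a real power series.\<close>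

lemma real_analytic_Re:
  assumes "\<And>x :: real. F analytic_on {of_real x}"
  shows "real_analytic (\<lambda>x. Re (F (of_real x)))"
  unfolding real_analytic_def
proof
  fix x :: real
  obtain r where r: "r > 0" "F holomorphic_on ball (of_real x) r"
    using assms[of x] by (auto simp: analytic_at_ball)
  define a where "a n = Re ((deriv ^^ n) F (of_real x) / fact n)" for n
  show "\<exists>r>0. \<exists>a. \<forall>y. \<bar>y - x\<bar> < r \<longrightarrow> (\<lambda>n. a n * (y - x) ^ n) sums Re (F (of_real y))"
  proof (rule exI[of _ r], intro conjI exI[of _ a] allI impI)
    fix y :: real
    assume "\<bar>y - x\<bar> < r"
    then have "complex_of_real y \<in> ball (of_real x) r"
      by (simp add: dist_of_real dist_real_def abs_minus_commute)
    note sums = sums_Re[OF holomorphic_power_series[OF r(2) this]]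
    have "Re (z * (of_real y - of_real x) ^ n) = Re z * (y - x) ^ n" for z n
      by (simp flip: of_real_diff of_real_power)
    with sums show "(\<lambda>n. a n * (y - x) ^ n) sums Re (F (of_real y))"
      by (simp only: a_def)
  qed (use r in simp)
qed


section \<open>The forcing function of Suris' map\<close>

definition suris :: "real \<Rightarrow> real \<Rightarrow> real" where
  "suris b x = - 2 / pi * phase (b\<^sup>2) (2 * pi * x)"

text \<open>This is the form F + F^(-1) - 2 id, with F a boost rescaled by pi. Each lift commutes
  only with translations by 2 in \<open>x\<close>, yet the sum has period 1.\<close>

lemma suris_conv_boost:
  "\<bar>b\<bar> < 1 \<Longrightarrow> suris b x = (boost b (pi * x) + boost (- b) (pi * x)) / pi - 2 * x"
  using phase_double[of b "pi * x"] by (simp add: suris_def boost_def field_simps)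

lemma suris_add_int: "k \<in> \<int> \<Longrightarrow> suris b (x + k) = suris b x"
  by (simp add: suris_def phase_add_2pi_int distrib_left)

lemma suris_minus: "\<bar>b\<bar> < 1 \<Longrightarrow> suris b (- x) = - suris b x"
  by (simp add: suris_def phase_minus abs_square_less_1)

lemma suris_bound: "\<bar>b\<bar> < 1 \<Longrightarrow> \<bar>suris b x\<bar> < 1"
  using phase_bound[of "b\<^sup>2" "2 * pi * x"]
  by (simp add: suris_def abs_mult abs_square_less_1 field_simps)

lemma suris_closed_form:
  assumes b: "0 < b" "b < 1" and x: "0 < x" "x < 1"
  shows "suris b x = 1 - 2 * x - 2 / pi * arctan ((1 - b\<^sup>2) / (1 + b\<^sup>2) * cot (pi * x))"
proof -
  have "0 < b\<^sup>2" "b\<^sup>2 < 1"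
    using b by (simp_all add: abs_square_less_1)
  from phase_closed_form[OF this, of "pi * x"] x show ?thesis
    by (simp add: suris_def field_simps)
qed

lemma suris_real_analytic:
  assumes "\<bar>b\<bar> < 1"
  shows "real_analytic (suris b)"
proof -
  \<comment> \<open>On the real axis the real part of \<i> \<open>Ln\<close> w is
    -\<open>Arg\<close> w, and w has positive real part there, hence avoids the branch cut.\<close>
  define F :: "complex \<Rightarrow> complex" where
    "F z = of_real (2 / pi) * (\<i> * Ln (1 - of_real (b\<^sup>2) * exp (\<i> * (2 * of_real pi * z))))" for z
  have b2: "\<bar>b\<^sup>2\<bar> < 1"
    using assms by (simp add: abs_square_less_1)
  have "F analytic_on {of_real x}" for x
  proof -
    have "0 < Re (1 - of_real (b\<^sup>2) * exp (\<i> * (2 * pi * of_real x)))"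
      using Re_phase_pos[OF b2, of "2 * pi * x"] by (simp add: cis_conv_exp)
    then show ?thesis
      unfolding F_def by (intro analytic_intros) (auto simp: complex_nonpos_Reals_iff)
  qed
  moreover have "Re (F (of_real x)) = suris b x" for x
    using phase_nonzero[OF b2, of "2 * pi * x"]
    by (simp add: F_def suris_def phase_def Arg_eq_Im_Ln cis_conv_exp)
  ultimately show ?thesis
    using real_analytic_Re[of F] by simp
qed

section \<open>Descent to the circle\<close>

lift_definition suris_circle :: "real \<Rightarrow> circle \<Rightarrow> real" is suris
proof -
  fix b x y :: real
  assume "x - y \<in> \<int>"
  from suris_add_int[OF this, of b y] show "suris b x = suris b y"
    by simp
qed

lemma to_circle_eq_iff: "to_circle x = to_circle y \<longleftrightarrow> x - y \<in> \<int>"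
  by (rule circle.abs_eq_iff)

lemma to_circle_cases: obtains x where "c = to_circle x"
  using circle.abs_induct[of "\<lambda>c. \<exists>x. c = to_circle x"] by blast

lemma to_circle_add: "to_circle x + to_circle y = to_circle (x + y)"
  by (rule plus_circle.abs_eq)

lemma suris_circle_analytic: "\<bar>b\<bar> < 1 \<Longrightarrow> circle_analytic (suris_circle b)"
  unfolding circle_analytic_def
  by (rule exI[of _ "suris b"]) (simp add: suris_real_analytic suris_add_int suris_circle.abs_eq)

text \<open>By oddness the integral over [0, 1] is minus the one over [-1, 0]; by periodicity the
  two are equal.\<close>

lemma suris_circle_integral:
  assumes "\<bar>b\<bar> < 1"
  shows "circle_integral (suris_circle b) = 0"
proof -
  have "integral {0..1} (suris b) = integral {-1..0} (\<lambda>x. suris b (- x))"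
    using Henstock_Kurzweil_Integration.integral_reflect_real[of 1 0 "suris b"] by simp
  also have "\<dots> = - integral {-1..0} (suris b)"
    using assms by (simp add: suris_minus)
  also have "integral {-1..0} (suris b) = integral {-1..0} (suris b \<circ> (+) 1)"
    using suris_add_int[of 1 b] by (simp add: o_def add.commute)
  also have "\<dots> = integral {0..1} (suris b)"
    using integral_shift_Icc_real[of "-1" 0 "suris b" 1] by simp
  finally show ?thesis
    by (simp add: circle_integral_def suris_circle.abs_eq)
qed

section \<open>Vertical rotation sets of general standard maps\<close>

lemma std_map_to_circle:
  "std_map g t (to_circle x, y) =
    (to_circle (x + (t * g (to_circle x) + y)), t * g (to_circle x) + y)"
  by (simp add: std_map_def Let_def to_circle_add)

lemma to_circle_1: "to_circle 1 = 0"
  by (simp add: zero_circle_def to_circle_eq_iff)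

lemma funpow_std_map_shift:
  "(std_map g t ^^ n) (map_prod id ((+) 1) X) = map_prod id ((+) 1) ((std_map g t ^^ n) X)"
proof (induction n)
  case (Suc n)
  have "std_map g t (map_prod id ((+) 1) X) = map_prod id ((+) 1) (std_map g t X)" for X
    by (cases X)
      (simp add: std_map_def Let_def add.left_commute[of _ 1] to_circle_1 flip: to_circle_add)
  with Suc show ?case
    by (simp only: funpow.simps o_apply)
qed simp

lemma tendsto_average:
  fixes a :: "nat \<Rightarrow> real"
  assumes "\<And>n. \<bar>a n - c * real n\<bar> \<le> M"
  shows "(\<lambda>n. a n / real n) \<longlonglongrightarrow> c"
proof -
  have "(\<lambda>n. (a n - c * real n) / real n) \<longlonglongrightarrow> 0"
  proof (rule Lim_null_comparison)
    show "\<forall>\<^sub>F n in sequentially. norm ((a n - c * real n) / real n) \<le> M / real n"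
      using assms by (auto intro!: always_eventually divide_right_mono)
    show "(\<lambda>n. M / real n) \<longlonglongrightarrow> 0"
      by real_asymp
  qed
  then have "(\<lambda>n. (a n - c * real n) / real n + c) \<longlonglongrightarrow> 0 + c"
    by (intro tendsto_intros)
  moreover have "\<forall>\<^sub>F n in sequentially. (a n - c * real n) / real n + c = a n / real n"
    using eventually_gt_at_top[of 0] by eventually_elim (simp add: field_simps)
  ultimately show ?thesis
    by (simp cong: filterlim_cong add: tendsto_cong)
qed

text \<open>The deviation \<open>d\<close> of the height from linear growth at speed 1/p is
  p-periodic, hence bounded, because the map commutes with the vertical unit shift.\<close>

lemma accelerator_orbit:
  assumes per: "(std_map g t ^^ p) X = map_prod id ((+) 1) X" and p: "p > 0"
  shows "1 / real p \<in> vertical_rotation_set (std_map g t)"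
proof -
  define d where "d n = snd ((std_map g t ^^ n) X) - real n / real p" for n
  have step: "d (n + p) = d n" for n
    unfolding d_def funpow_add o_apply per funpow_std_map_shift
    using p by (simp add: add_divide_distrib)
  have "d (m + k * p) = d m" for m k
  proof (induction k)
    case (Suc k)
    then show ?case
      using step[of "m + k * p"] by (simp add: algebra_simps)
  qed simp
  from this[of "n mod p" "n div p" for n] have "d n \<in> d ` {..<p}" for n
    using p by (metis mod_mult_div_eq mult.commute image_eqI lessThan_iff mod_less_divisor)
  then have "range d \<subseteq> d ` {..<p}"
    by auto
  then have "bounded (range d)"
    by (meson bounded_subset finite_imageI finite_imp_bounded finite_lessThan)
  then obtain M where M: "\<bar>d n\<bar> \<le> M" for n
    unfolding bounded_iff by auto
  have "(\<lambda>n. (snd ((std_map g t ^^ n) X) - snd X) / real n) \<longlonglongrightarrow> 1 / real p"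
  proof (rule tendsto_average)
    fix n
    show "\<bar>snd ((std_map g t ^^ n) X) - snd X - 1 / real p * real n\<bar> \<le> M + \<bar>snd X\<bar>"
      using M[of n] by (simp add: d_def)
  qed
  then show ?thesis
    unfolding vertical_rotation_set_def by blast
qed

text \<open>One iteration raises the height by at most |t| M. Boundedness is what makes
  \<open>Sup\<close> an upper bound of the set.\<close>

lemma vertical_rotation_set_bdd_above:
  assumes "\<And>x. \<bar>g x\<bar> \<le> M"
  shows "bdd_above (vertical_rotation_set (std_map g t))"
proof (rule bdd_aboveI)
  have M: "M \<ge> 0"
    using assms[of undefined] by linarith
  fix w
  assume "w \<in> vertical_rotation_set (std_map g t)"
  then obtain X where X: "(\<lambda>n. (snd ((std_map g t ^^ n) X) - snd X) / real n) \<longlonglongrightarrow> w"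
    by (auto simp: vertical_rotation_set_def)
  have "snd ((std_map g t ^^ n) X) - snd X \<le> \<bar>t\<bar> * M * real n" for n
  proof (induction n)
    case (Suc n)
    have "t * g x \<le> \<bar>t\<bar> * M" for x
    proof -
      have "t * g x \<le> \<bar>t\<bar> * \<bar>g x\<bar>"
        by (metis abs_ge_self abs_mult)
      also have "\<dots> \<le> \<bar>t\<bar> * M"
        by (intro mult_left_mono assms) simp
      finally show ?thesis .
    qed
    then have "snd (std_map g t Y) \<le> \<bar>t\<bar> * M + snd Y" for Y
      by (cases Y) (simp add: std_map_def Let_def)
    from this[of "(std_map g t ^^ n) X"] Suc show ?case
      by (simp add: algebra_simps)
  qed simp
  then have "(snd ((std_map g t ^^ n) X) - snd X) / real n \<le> \<bar>t\<bar> * M" for n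
    using M by (cases "n = 0") (simp_all add: field_simps)
  then show "w \<le> \<bar>t\<bar> * M"
    by (intro LIMSEQ_le_const2[OF X]) blast
qed

text \<open>Monotonicity of \<open>H\<close> traps every orbit between two vertical translates of
  the invariant graph, so all heights stay bounded.\<close>

lemma rotation_set_integrable:
  assumes b: "\<bar>b\<bar> < 1"
  shows "vertical_rotation_set (std_map (suris_circle b) 1) = {0}"
proof -
  let ?S = "std_map (suris_circle b) 1"
  define F where "F x = boost (- b) (pi * x) / pi" for x
  define H where "H x = boost b (pi * x) / pi" for x
  have HF: "H (F x) = x" for x
    by (simp add: H_def F_def boost_inverse[OF b])
  have mono: "H x \<le> H y \<longleftrightarrow> x \<le> y" for x y
    using strict_mono_less_eq[OF boost_strict_mono[OF b]]
    by (simp add: H_def divide_le_cancel)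
  have H_shift: "H (x + 2 * of_int k) = H x + 2 * of_int k" for x and k :: int
    using boost_add_2pi_int[of "of_int k" b "pi * x"] by (simp add: H_def field_simps)
  have H_near: "\<bar>x - H x\<bar> < 1" for x
    using phase_bound[OF b, of "pi * x"] by (simp add: H_def boost_def field_simps abs_mult)
  \<comment> \<open>The invariant graph \<open>y = x - H x\<close> has period 2 in \<open>x\<close>, so only its vertical translates by even
    integers are invariant. The lift \<open>x\<close> of the first coordinate is not unique, hence the existential.\<close>
  define inside where "inside k X \<longleftrightarrow> (\<exists>x. fst X = to_circle x \<and>
      x - H x - 2 * of_int k \<le> snd X \<and> snd X \<le> x - H x + 2 * of_int k)" for k :: int and X
  have step: "inside k (?S X)" if "inside k X" for k X
  proof -
    from that obtain x where x: "fst X = to_circle x"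
      "x - H x - 2 * of_int k \<le> snd X" "snd X \<le> x - H x + 2 * of_int k"
      by (auto simp: inside_def)
    define y' where "y' = suris b x + snd X"
    have y': "y' = F x + H x - 2 * x + snd X"
      by (simp add: y'_def suris_conv_boost[OF b] F_def H_def add_divide_distrib)
    \<comment> \<open>The new lift \<open>x + y'\<close> differs from \<open>F x\<close> by exactly
      the height of the point above the graph; applying \<open>H\<close> compares
      \<open>H (x + y')\<close> with \<open>x\<close>, which is the same comparison at the image
      point.\<close>
    have "H (x + y') \<le> H (F x + 2 * of_int k)"
      unfolding mono using x(3) y' by simp
    moreover have "H (F x + 2 * of_int (- k)) \<le> H (x + y')"
      unfolding mono using x(2) y' by simp
    ultimately have "x - 2 * of_int k \<le> H (x + y')" "H (x + y') \<le> x + 2 * of_int k"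
      unfolding H_shift HF by simp_all
    moreover have "?S X = (to_circle (x + y'), y')"
      using std_map_to_circle[of "suris_circle b" 1 x "snd X"] x(1)
      by (metis y'_def mult_1 prod.collapse suris_circle.abs_eq)
    ultimately show ?thesis
      unfolding inside_def by (intro exI[of _ "x + y'"]) simp
  qed
  have lim: "(\<lambda>n. (snd ((?S ^^ n) X) - snd X) / real n) \<longlonglongrightarrow> 0" for X
  proof -
    obtain x where x: "fst X = to_circle x"
      by (rule to_circle_cases)
    obtain k :: int where k: "\<bar>snd X\<bar> + 1 \<le> of_int k"
      using ex_le_of_int by blast
    have "inside k X"
      unfolding inside_def using x k H_near[of x] by (intro exI[of _ x]) auto
    then have "inside k ((?S ^^ n) X)" for n :: nat
      by (induction n) (auto intro: step)
    have "\<bar>snd ((?S ^^ n) X) - snd X - 0 * real n\<bar> \<le> 1 + 2 * of_int k + \<bar>snd X\<bar>" for n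
    proof -
      from \<open>inside k ((?S ^^ n) X)\<close> obtain x' where
        "x' - H x' - 2 * of_int k \<le> snd ((?S ^^ n) X)" "snd ((?S ^^ n) X) \<le> x' - H x' + 2 * of_int k"
        unfolding inside_def by blast
      with H_near[of x'] show ?thesis
        by linarith
    qed
    then show ?thesis
      by (rule tendsto_average)
  qed
  then show ?thesis
    unfolding vertical_rotation_set_def using LIMSEQ_unique by blast
qed

section \<open>Comparison of \<open>suris b\<close> with the sawtooth 1 - 2x\<close>

lemma arctan_le_self:
  fixes x :: real
  assumes "0 \<le> x"
  shows "arctan x \<le> x"
proof -
  have "0 - arctan 0 \<le> x - arctan x"
  proof (rule DERIV_nonneg_imp_nondecreasing[OF assms])
    fix u :: real
    have "((\<lambda>x. x - arctan x) has_real_derivative 1 - inverse (1 + u\<^sup>2)) (at u)"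
      by (rule derivative_eq_intros refl)+ simp
    moreover have "inverse (1 + u\<^sup>2) \<le> 1"
      by (simp add: inverse_le_1_iff)
    ultimately show "\<exists>y. ((\<lambda>x. x - arctan x) has_real_derivative y) (at u) \<and> 0 \<le> y"
      by (metis diff_ge_0_iff_ge)
  qed
  then show ?thesis
    by simp
qed

lemma cot_le_inverse:
  fixes x :: real
  assumes "0 < x" "x < pi / 2"
  shows "0 < cot x" "cot x \<le> 1 / x"
proof -
  have t: "tan x > 0"
    using assms by (simp add: tan_gt_zero)
  have "x \<le> tan x"
    using arctan_le_self[of "tan x"] arctan_tan[of x] assms t by simp
  with t assms show "0 < cot x" "cot x \<le> 1 / x"
    by (simp_all add: cot_altdef divide_simps)
qed

lemma suris_le:
  assumes "0 < b" "b < 1" "0 < x" "x < 1 / 2"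
  shows "suris b x \<le> 1 - 2 * x"
proof -
  have "b\<^sup>2 < 1"
    using assms by (simp add: abs_square_less_1)
  then have "0 \<le> (1 - b\<^sup>2) / (1 + b\<^sup>2) * cot (pi * x)"
    using cot_le_inverse(1)[of "pi * x"] assms by (simp add: add_pos_nonneg)
  then have "0 \<le> 2 / pi * arctan ((1 - b\<^sup>2) / (1 + b\<^sup>2) * cot (pi * x))"
    by (intro mult_nonneg_nonneg) (simp_all only: zero_le_arctan_iff, simp)
  then show ?thesis
    using suris_closed_form[of b x] assms by linarith
qed

lemma suris_ge_right:
  assumes "0 < b" "b < 1" "1 / 2 \<le> x" "x < 1"
  shows "1 - 2 * x \<le> suris b x"
proof -
  have "b\<^sup>2 < 1"
    using assms by (simp add: abs_square_less_1)
  moreover have "cot (pi * x) \<le> 0"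
  proof -
    have "cos (pi * x) \<le> cos (pi / 2)"
      using assms by (intro cos_monotone_0_pi_le) auto
    moreover have "0 < sin (pi * x)"
      using assms by (intro sin_gt_zero) auto
    ultimately show ?thesis
      by (simp add: cot_def divide_le_0_iff)
  qed
  ultimately have "(1 - b\<^sup>2) / (1 + b\<^sup>2) * cot (pi * x) \<le> 0"
    by (intro mult_nonneg_nonpos) simp_all
  then show ?thesis
    using suris_closed_form[of b x] assms by (simp add: mult_nonneg_nonpos divide_le_0_iff)
qed

text \<open>The arctangent correction is bounded through arctan u \<le> u and cot u \<le> 1/u; then
  pi > 3 replaces 2/pi^2 by the rational 1/4.\<close>

lemma suris_ge_left:
  assumes "0 < b" "b < 1" "0 < x" "x < 1 / 2"
  shows "1 - 2 * x - (1 - b\<^sup>2) / (1 + b\<^sup>2) / (4 * x) \<le> suris b x"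
proof -
  define \<epsilon> where "\<epsilon> = (1 - b\<^sup>2) / (1 + b\<^sup>2)"
  have "b\<^sup>2 < 1"
    using assms by (simp add: abs_square_less_1)
  then have \<epsilon>: "0 \<le> \<epsilon>"
    by (simp add: \<epsilon>_def)
  have cot: "0 < cot (pi * x)" "cot (pi * x) \<le> 1 / (pi * x)"
    using cot_le_inverse[of "pi * x"] assms by auto
  have "arctan (\<epsilon> * cot (pi * x)) \<le> \<epsilon> * cot (pi * x)"
    using \<epsilon> cot by (intro arctan_le_self mult_nonneg_nonneg) auto
  also have "\<dots> \<le> \<epsilon> * (1 / (pi * x))"
    using \<epsilon> cot by (intro mult_left_mono)
  finally have "2 / pi * arctan (\<epsilon> * cot (pi * x)) \<le> 2 / pi * (\<epsilon> * (1 / (pi * x)))"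
    by (intro mult_left_mono) auto
  also have "\<dots> = \<epsilon> / x * (2 / pi\<^sup>2)"
    by (simp add: power2_eq_square mult_ac)
  also have "\<dots> \<le> \<epsilon> / x * (1 / 4)"
  proof (rule mult_left_mono)
    have "3\<^sup>2 \<le> pi\<^sup>2"
      using pi_gt3 by (intro power_mono) auto
    then show "2 / pi\<^sup>2 \<le> 1 / 4"
      by (simp add: field_simps)
    show "0 \<le> \<epsilon> / x"
      using \<epsilon> assms by (intro divide_nonneg_nonneg) auto
  qed
  finally show ?thesis
    using suris_closed_form[of b x] assms by (simp add: mult.commute flip: \<epsilon>_def)
qed

lemma continuous_on_suris:
  fixes f :: "'a::t2_space \<Rightarrow> real"
  assumes "\<bar>b\<bar> < 1" "continuous_on A f"
  shows "continuous_on A (\<lambda>x. suris b (f x))"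
  unfolding suris_def using assms
  by (intro continuous_intros continuous_on_phase) (auto simp: abs_square_less_1)

text \<open>The closing equation is solved by the intermediate value theorem between 0, where
  \<open>\<Phi>\<close> vanishes, and a nearby point where \<open>\<Phi>\<close> is at least
  1.\<close>

lemma suris_accelerator:
  assumes b: "999 / 1000 \<le> b" "b < 1"
  shows "\<exists>X. (std_map (suris_circle b) (3 / 4) ^^ 4) X = map_prod id ((+) 1) X"
proof -
  let ?G = "suris b"
  define \<epsilon> where "\<epsilon> = (1 - b\<^sup>2) / (1 + b\<^sup>2)"
  have b': "0 < b" "\<bar>b\<bar> < 1"
    using b by auto
  have "(999 / 1000)\<^sup>2 \<le> b\<^sup>2"
    using b by (intro power_mono) auto
  then have \<epsilon>: "\<epsilon> \<le> 1 / 500"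
    by (simp add: \<epsilon>_def field_simps power2_eq_square)
  note suris_ge_left = suris_ge_left[of b, folded \<epsilon>_def]
  have G0: "?G 0 = 0"
    using suris_minus[OF b'(2), of 0] by simp
  \<comment> \<open>The orbit sought has first coordinates \<open>s\<close>, \<open>s + V/2\<close>, \<open>s + V + W\<close>, \<open>s + V/2 + 1\<close> and starts
    with \<open>y = -V/2\<close>. Being symmetric under time reversal, it closes up as soon as \<open>\<Phi> s = 1\<close>.\<close>
  define V where "V s = 3 / 4 * ?G s" for s
  define W where "W s = 3 / 4 * ?G (s + V s / 2)" for s
  define \<Phi> where "\<Phi> s = V s + 2 * W s + 3 / 4 * ?G (s + V s + W s)" for s
  note cont_G = continuous_on_suris[OF b'(2)]
  have cont_V: "continuous_on A V" for A
    unfolding V_def[abs_def]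
    by (rule continuous_on_mult[OF continuous_on_const cont_G[OF continuous_on_id]])
  have cont_W: "continuous_on A W" for A
    unfolding W_def[abs_def]
    by (intro continuous_on_mult[OF continuous_on_const cont_G] continuous_on_add
        continuous_on_divide continuous_on_id continuous_on_const cont_V) simp
  have cont: "continuous_on A \<Phi>" for A
    unfolding \<Phi>_def[abs_def]
    by (intro continuous_on_add cont_V cont_W continuous_on_mult[OF continuous_on_const]
        cont_G continuous_on_id)
  have \<Phi>0: "\<Phi> 0 = 0"
    by (simp add: \<Phi>_def W_def V_def G0)
  \<comment> \<open>Inside the smoothed jump \<open>?G\<close> climbs from 0 past 1/10. Fixing the
    value 1/10 gives a kick that carries the next point clear of the jump, where the sawtooth
    estimates are sharp.\<close>
  obtain s where s: "0 \<le> s" "s \<le> 1 / 100" "?G s = 1 / 10"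
  proof -
    have "1 / 10 \<le> ?G (1 / 100)"
      using suris_ge_left[of "1 / 100"] b \<epsilon> by simp
    then show thesis
      using IVT'[of ?G 0 "1 / 10" "1 / 100"] G0 that
        continuous_on_suris[OF b'(2), of _ "\<lambda>x. x"] by (auto simp: continuous_on_id)
  qed
  have "1 \<le> \<Phi> s"
  proof -
    have V: "V s = 3 / 40"
      by (simp add: V_def s)
    let ?x = "s + 3 / 80" and ?y = "s + 3 / 40 + W s"
    have W: "W s = 3 / 4 * ?G ?x"
      by (simp add: W_def V)
    have "?G ?x \<le> 1 - 2 * ?x"
      using s b b' by (intro suris_le) auto
    moreover have "1 - 2 * ?x - \<epsilon> / (4 * ?x) \<le> ?G ?x"
      using s b b' by (intro suris_ge_left) auto
    moreover have "\<epsilon> / (4 * ?x) \<le> (1 / 500) / (3 / 20)"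
      using \<epsilon> s by (intro frac_le) auto
    ultimately have x: "?G ?x \<le> 1 - 2 * ?x" "1 - 2 * ?x - 1 / 75 \<le> ?G ?x"
      by simp_all
    \<comment> \<open>The two-sided bound on \<open>W s\<close> places \<open>?y\<close> in [1/2,
      1).\<close>
    have y: "1 - 2 * ?y \<le> ?G ?y"
      using s x b b' W by (intro suris_ge_right) auto
    \<comment> \<open>The bound on \<open>g\<close> costs 3/2 w, leaving w with net coefficient 1/2,
      so a lower bound on w suffices.\<close>
    have "1 \<le> 3 / 40 + 2 * w + 3 / 4 * g"
      if "1 - 2 * (s + 3 / 40 + w) \<le> g" "3 / 4 * (1 - 2 * (s + 3 / 80) - 1 / 75) \<le> w" for w g
      using that s(2) by (simp add: field_simps)
    from this[OF y] x(2) show ?thesis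
      unfolding \<Phi>_def V W by simp
  qed
  then obtain s where s: "\<Phi> s = 1"
    using IVT'[of \<Phi> 0 1 s] \<Phi>0 s(1) cont by auto
  let ?v = "V s" and ?w = "W s"
  let ?S = "std_map (suris_circle b) (3 / 4)"
  have S: "?S (to_circle x, y) = (to_circle (x + (3 / 4 * ?G x + y)), 3 / 4 * ?G x + y)" for x y
    by (simp add: std_map_to_circle suris_circle.abs_eq)
  have G1: "?G (x + 1) = ?G x" for x
    by (simp add: suris_add_int)
  have "?S (to_circle s, - ?v / 2) = (to_circle (s + ?v / 2), ?v / 2)"
    unfolding S V_def[symmetric] by simp
  moreover have "?S (to_circle (s + ?v / 2), ?v / 2) = (to_circle (s + ?v + ?w), ?v / 2 + ?w)"
    unfolding S W_def[symmetric] by (simp add: algebra_simps)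
  moreover have "?S (to_circle (s + ?v + ?w), ?v / 2 + ?w)
      = (to_circle (s + ?v / 2 + 1), 1 - (?v / 2 + ?w))"
  proof -
    have "3 / 4 * ?G (s + ?v + ?w) = 1 - ?v - 2 * ?w"
      using s by (simp add: \<Phi>_def)
    then show ?thesis
      unfolding S by (simp only:) (simp add: field_simps)
  qed
  \<comment> \<open>By periodicity the force is \<open>W s\<close> once more, and the lift arrives
    at s + 2.\<close>
  moreover have "?S (to_circle (s + ?v / 2 + 1), 1 - (?v / 2 + ?w)) = (to_circle s, 1 + - ?v / 2)"
    unfolding S G1 W_def[symmetric] by (simp add: to_circle_eq_iff)
  ultimately have "(?S ^^ 4) (to_circle s, - ?v / 2) = (to_circle s, 1 + - ?v / 2)"
    by (simp add: eval_nat_numeral)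
  then show ?thesis
    by (intro exI[of _ "(to_circle s, - ?v / 2)"]) simp
qed

theorem theorem1:
  "\<exists>g :: circle \<Rightarrow> real.
     circle_analytic g \<and> g \<noteq> (\<lambda>x. 0) \<and> circle_integral g = 0 \<and>
     \<not> mono_on {0..} (\<lambda>t :: real. rho_V_max (std_map g t))"
proof -
  define b :: real where "b = 999 / 1000"
  let ?g = "suris_circle b"
  have b: "\<bar>b\<bar> < 1" "999 / 1000 \<le> b" "b < 1"
    by (simp_all add: b_def)
  have bound: "\<bar>?g x\<bar> \<le> 1" for x
    by (rule to_circle_cases[of x]) (simp add: suris_circle.abs_eq suris_bound b less_imp_le)
  obtain X where "(std_map ?g (3 / 4) ^^ 4) X = map_prod id ((+) 1) X"
    using suris_accelerator[OF b(2,3)] by blast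
  from accelerator_orbit[OF this] have "1 / 4 \<in> vertical_rotation_set (std_map ?g (3 / 4))"
    by simp
  then have "1 / 4 \<le> rho_V_max (std_map ?g (3 / 4))"
    unfolding rho_V_max_def by (rule cSup_upper) (rule vertical_rotation_set_bdd_above[OF bound])
  moreover have "rho_V_max (std_map ?g 1) = 0"
    by (simp add: rho_V_max_def rotation_set_integrable[OF b(1)])
  \<comment> \<open>The value is at least 1/4 at parameter 3/4 but 0 at parameter 1.\<close>
  ultimately have "\<not> mono_on {0..} (\<lambda>t. rho_V_max (std_map ?g t))"
    using mono_onD[of "{0..}" "\<lambda>t. rho_V_max (std_map ?g t)" "3 / 4" 1] by auto
  moreover have "?g \<noteq> (\<lambda>x. 0)"
  proof
    assume "?g = (\<lambda>x. 0)"
    then have "suris b (1 / 4) = 0"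
      by (metis suris_circle.abs_eq)
    \<comment> \<open>At 1/4 the lower estimate reads 1/2 - (1 - b^2) / (1 + b^2).\<close>
    moreover have "0 < suris b (1 / 4)"
      using suris_ge_left[of b "1 / 4"] by (simp add: b_def power2_eq_square)
    ultimately show False
      by simp
  qed
  ultimately show ?thesis
    using suris_circle_analytic[OF b(1)] suris_circle_integral[OF b(1)] by blast
qed

end
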